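(* Let $D,E$ be two bounded open (resp., closed) sets in $\mathbb{H}$. If $D\subset E$, then $\operatorname{co}(D)\subset\operatorname{co}(E)$ and $$\inf\{\tilde d_H(p,q):p\in\operatorname{co}(D),\ q\in\mathbb{H}\setminus\operatorname{co}(E)\}\ \ge\ \inf\{\tilde d_H(p,q):p\in D,\ q\in\mathbb{H}\setminus E\}.$$
   Context: The Heisenberg group $\mathbb{H}$ is $\mathbb{R}^3$ (with its usual topology) with the group law $(x_p,y_p,z_p)\cdot(x_q,y_q,z_q)=(x_p+x_q,\,y_p+y_q,\,z_p+z_q+\frac12(x_py_q-x_qy_p))$. Let $\mathbb{H}_0=\{(x,y,0):x,y\in\mathbb{R}\}$ and, for $p\in\mathbb{H}$, $\mathbb{H}_p=\{p\cdot h:h\in\mathbb{H}_0\}$. For $q\in\mathbb{H}_p$, $[p,q]$ denotes the horizontal segment joining $p$ and $q$ (the straight segment from $p$ to $q$). The Kor\'anyi gauge is $|(x,y,z)|_G=((x^2+y^2)^2+16z^2)^{1/4}$, and $\tilde d_H(p,q)=|p\cdot q^{-1}|_G$ is the right invariant gauge metric. A set $E\subset\mathbb{H}$ is h-convex if $[p,q]\subset E$ for every $p\in E$ and $q\in\mathbb{H}_p\cap E$. The h-convex hull $\operatorname{co}(E)$ is the intersection of all h-convex sets in $\mathbb{H}$ containing $E$. *)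

theory Defs
  imports "HOL-Analysis.Analysis" "HOL-Library.Extended_Real"
begin

text \<open>
  The Heisenberg group is realised on the Euclidean space
  \<^typ>\<open>real \<times> real \<times> real\<close>, so \<^const>\<open>open\<close>, \<^const>\<open>closed\<close>,
  \<^const>\<open>bounded\<close> and \<^const>\<open>closed_segment\<close> have their usual Euclidean meaning.
\<close>

type_synonym heis = "real \<times> real \<times> real"

fun hmul :: "heis \<Rightarrow> heis \<Rightarrow> heis" (infixl "\<odot>" 70) where
  "(xp, yp, zp) \<odot> (xq, yq, zq) =
     (xp + xq, yp + yq, zp + zq + 1/2 * (xp * yq - xq * yp))"

fun hinv :: "heis \<Rightarrow> heis" where
  "hinv (x, y, z) = (- x, - y, - z)"

lemma hmul_assoc: "(p \<odot> q) \<odot> r = p \<odot> (q \<odot> r)"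
  by (cases p; cases q; cases r) (simp add: field_simps)

lemma hmul_zero: "0 \<odot> p = p" "p \<odot> 0 = p"
  by (cases p; simp add: zero_prod_def)+

lemma hmul_hinv: "p \<odot> hinv p = 0" "hinv p \<odot> p = 0"
  by (cases p; simp add: zero_prod_def)+

definition H0 :: "heis set" where
  "H0 = {(x, y, 0) | x y. True}"

definition hplane :: "heis \<Rightarrow> heis set" where
  "hplane p = {p \<odot> h | h. h \<in> H0}"

fun gauge_G :: "heis \<Rightarrow> real" where
  "gauge_G (x, y, z) = root 4 ((x\<^sup>2 + y\<^sup>2)\<^sup>2 + 16 * z\<^sup>2)"

definition dH :: "heis \<Rightarrow> heis \<Rightarrow> real" where
  "dH p q = gauge_G (p \<odot> hinv q)"

definition h_convex :: "heis set \<Rightarrow> bool" where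
  "h_convex E \<longleftrightarrow> (\<forall>p\<in>E. \<forall>q\<in>hplane p \<inter> E. closed_segment p q \<subseteq> E)"

definition co :: "heis set \<Rightarrow> heis set" where
  "co E = \<Inter>{F. h_convex F \<and> E \<subseteq> F}"

text \<open>
  The infimum is taken in \<^typ>\<open>ereal\<close>, so that the infimum over an empty set
  of pairs is \<open>\<infinity>\<close>.
\<close>

definition inf_dH :: "heis set \<Rightarrow> heis set \<Rightarrow> ereal" where
  "inf_dH A B = Inf {ereal (dH p q) | p q. p \<in> A \<and> q \<in> B}"

end

theory Submission
  imports Defs
begin

text \<open>
  Left translations are affine and map horizontal planes to horizontal planes, so they preserve
  h-convexity and commute with \<^const>\<open>co\<close>. The right invariant gauge ball of radius
  \<open>r\<close> about \<open>p\<close> consists of the points \<open>u \<odot> p\<close> with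
  \<open>gauge_G u < r\<close>. Hence the distance from \<open>D\<close> to the complement of \<open>E\<close> is at
  least \<open>r\<close> iff every left translate of \<open>D\<close> by such a \<open>u\<close> stays inside \<open>E\<close>,
  a property that passes to the hulls.
\<close>

lemma gauge_G_hinv: "gauge_G (hinv p) = gauge_G p"
  by (cases p) simp

lemma hinv_hmul: "hinv (p \<odot> q) = hinv q \<odot> hinv p"
  by (cases p; cases q) (simp add: field_simps)

lemma hinv_hinv: "hinv (hinv p) = p"
  by (cases p) simp

lemma dH_commute: "dH p q = dH q p"
  unfolding dH_def by (metis gauge_G_hinv hinv_hmul hinv_hinv)

lemma dH_hmul_left: "dH (u \<odot> p) p = gauge_G u"
  by (simp add: dH_def hmul_assoc hmul_hinv hmul_zero)

text \<open>For fixed \<open>u\<close> the twist term of the group law is linear in the right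
  factor.\<close>

lemma hmul_left_affine:
  "u \<odot> ((1 - t) *\<^sub>R p + t *\<^sub>R q) = (1 - t) *\<^sub>R (u \<odot> p) + t *\<^sub>R (u \<odot> q)"
  by (cases u; cases p; cases q) (simp add: field_simps)

lemma hmul_left_closed_segment:
  assumes "x \<in> closed_segment p q"
  shows "u \<odot> x \<in> closed_segment (u \<odot> p) (u \<odot> q)"
  using assms unfolding in_segment by (metis hmul_left_affine)

lemma hmul_left_hplane: "q \<in> hplane p \<Longrightarrow> u \<odot> q \<in> hplane (u \<odot> p)"
  unfolding hplane_def by (auto simp: hmul_assoc)

lemma h_convex_vimage_hmul:
  assumes "h_convex F"
  shows "h_convex ((\<odot>) u -` F)"
  unfolding h_convex_def
proof (intro ballI subsetI)
  fix p q x
  assume p: "p \<in> (\<odot>) u -` F" and q: "q \<in> hplane p \<inter> (\<odot>) u -` F"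
    and x: "x \<in> closed_segment p q"
  have "closed_segment (u \<odot> p) (u \<odot> q) \<subseteq> F"
    using assms p q hmul_left_hplane unfolding h_convex_def by auto
  then show "x \<in> (\<odot>) u -` F"
    using hmul_left_closed_segment[OF x, of u] by blast
qed

text \<open>Pulling back along \<open>u\<close>: the preimage of each h-convex \<open>F\<close>
  containing \<open>E\<close> is h-convex and contains \<open>D\<close>, hence contains
  \<open>co D\<close>.\<close>

lemma co_hmul_left:
  assumes "\<And>p. p \<in> D \<Longrightarrow> u \<odot> p \<in> E" and "p \<in> co D"
  shows "u \<odot> p \<in> co E"
  unfolding co_def
proof safe
  fix F assume "h_convex F" "E \<subseteq> F"
  then have "h_convex ((\<odot>) u -` F)" "D \<subseteq> (\<odot>) u -` F"
    using assms(1) h_convex_vimage_hmul by blast+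
  then show "u \<odot> p \<in> F"
    using assms(2) unfolding co_def by blast
qed

lemma co_mono: "D \<subseteq> E \<Longrightarrow> co D \<subseteq> co E"
  unfolding co_def by blast

lemma inf_dH_co: "inf_dH D (- E) \<le> inf_dH (co D) (- co E)"
proof -
  have "inf_dH D (- E) \<le> ereal (dH p q)" if p: "p \<in> co D" and q: "q \<notin> co E" for p q
  proof (rule ccontr)
    assume less: "\<not> inf_dH D (- E) \<le> ereal (dH p q)"
    \<comment> \<open>Left translation by \<open>u\<close> carries \<open>p\<close> to
      \<open>q\<close> and, by right invariance, moves every point by the same distance
      \<open>dH p q\<close>.\<close>
    define u where "u = q \<odot> hinv p"
    have "u \<odot> d \<in> E" if "d \<in> D" for d
    proof (rule ccontr)
      assume "u \<odot> d \<notin> E"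
      then have "inf_dH D (- E) \<le> ereal (dH d (u \<odot> d))"
        unfolding inf_dH_def using that by (intro Inf_lower) blast
      moreover have "dH d (u \<odot> d) = dH p q"
        using dH_commute dH_hmul_left by (simp add: u_def dH_def)
      ultimately show False
        using less by simp
    qed
    then have "u \<odot> p \<in> co E"
      using co_hmul_left p by blast
    then show False
      using q by (simp add: u_def hmul_assoc hmul_hinv hmul_zero)
  qed
  then show ?thesis
    unfolding inf_dH_def[of "co D"] by (intro Inf_greatest) auto
qed

theorem theorem5p4:
  fixes D E :: "heis set"
  assumes "bounded D" and "bounded E"
    and "(open D \<and> open E) \<or> (closed D \<and> closed E)"
    and "D \<subseteq> E"
  shows "co D \<subseteq> co E \<and> inf_dH (co D) (UNIV - co E) \<ge> inf_dH D (UNIV - E)"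
  using co_mono[OF \<open>D \<subseteq> E\<close>] inf_dH_co[of D E] by (simp add: Compl_eq_Diff_UNIV)

end
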